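(* For any probability measure space $(X,\mathscr{A},\mu)$, the quasicomponent, component and path component of each point in $\mathcal{M}_\mu$ coincide.
   Context: $\mathcal{M}$ is the ring of real-valued measurable functions on $(X,\mathscr{A},\mu)$, where two functions that are equal $\mu$-almost everywhere are identified. A sequence $\{f_n\}$ in $\mathcal{M}$ converges in measure to $f\in\mathcal{M}$ if for each $c>0$, $\lim_{n\to\infty}\mu(\{x\in X:|f_n(x)-f(x)|>c\})=0$. For $A\subseteq\mathcal{M}$, $\overline{A}$ is the set of all $f\in\mathcal{M}$ for which there is a sequence in $A$ converging to $f$ in measure. $\mathcal{M}_\mu$ denotes $\mathcal{M}$ with the topology of convergence in measure, i.e. the topology $\{\mathcal{M}\setminus A: A\subseteq\mathcal{M},\ A=\overline{A}\}$. In a topological space $Y$, the quasicomponent of $y\in Y$ is the intersection of all clopen subsets of $Y$ containing $y$; the component (resp. path component) of $y$ is the largest connected (resp. path connected) subset of $Y$ containing $y$. *)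

theory Defs
  imports "HOL-Probability.Probability"
begin

definition ae_eq :: "'a measure \<Rightarrow> (('a \<Rightarrow> real) \<times> ('a \<Rightarrow> real)) set" where
  "ae_eq M = {(f, g). f \<in> borel_measurable M \<and> g \<in> borel_measurable M \<and> (AE x in M. f x = g x)}"

lemma equiv_ae_eq: "equiv (borel_measurable M) (ae_eq M)"
proof (rule equivI)
  show "ae_eq M \<subseteq> borel_measurable M \<times> borel_measurable M"
    by (auto simp: ae_eq_def)
  show "refl_on (borel_measurable M) (ae_eq M)"
    by (simp add: refl_on_def ae_eq_def)
  show "sym (ae_eq M)"
    by (simp add: sym_def ae_eq_def eq_commute)
  show "trans (ae_eq M)"
  proof (rule transI)
    fix f g h assume "(f, g) \<in> ae_eq M" "(g, h) \<in> ae_eq M"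
    then have m: "f \<in> borel_measurable M" "h \<in> borel_measurable M"
      and fg: "AE x in M. f x = g x" and gh: "AE x in M. g x = h x"
      by (simp_all add: ae_eq_def)
    have "AE x in M. f x = h x"
      using fg gh by eventually_elim simp
    then show "(f, h) \<in> ae_eq M" using m by (simp add: ae_eq_def)
  qed
qed

text \<open>The points are equivalence classes of HOL-total functions. The values of a representative
  outside \<open>space M\<close> are irrelevant, as they are not seen by \<open>ae_eq\<close>.\<close>

definition measurable_classes :: "'a measure \<Rightarrow> ('a \<Rightarrow> real) set set" where
  "measurable_classes M = borel_measurable M // ae_eq M"

definition converges_in_measure :: "'a measure \<Rightarrow> (nat \<Rightarrow> 'a \<Rightarrow> real) \<Rightarrow> ('a \<Rightarrow> real) \<Rightarrow> bool" where
  "converges_in_measure M f g \<longleftrightarrow>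
     (\<forall>c>0. (\<lambda>n. emeasure M {x \<in> space M. \<bar>f n x - g x\<bar> > c}) \<longlonglongrightarrow> 0)"

text \<open>For classes, convergence does not depend on the representatives; see
  \<open>class_converges_iff\<close>.\<close>

definition class_converges :: "'a measure \<Rightarrow> (nat \<Rightarrow> ('a \<Rightarrow> real) set) \<Rightarrow> ('a \<Rightarrow> real) set \<Rightarrow> bool" where
  "class_converges M F G \<longleftrightarrow>
     (\<exists>f g. (\<forall>n. f n \<in> F n) \<and> g \<in> G \<and> converges_in_measure M f g)"

definition measure_closure :: "'a measure \<Rightarrow> ('a \<Rightarrow> real) set set \<Rightarrow> ('a \<Rightarrow> real) set set" where
  "measure_closure M A =
     {G \<in> measurable_classes M. \<exists>F. (\<forall>n. F n \<in> A) \<and> class_converges M F G}"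

definition measure_topology :: "'a measure \<Rightarrow> ('a \<Rightarrow> real) set topology" where
  "measure_topology M = topology (\<lambda>U. \<exists>A \<subseteq> measurable_classes M.
     A = measure_closure M A \<and> U = measurable_classes M - A)"

lemma measurable_class_rep:
  assumes "F \<in> measurable_classes M" "f \<in> F"
  shows "f \<in> borel_measurable M"
  using assms equiv_ae_eq[of M] unfolding measurable_classes_def
  by (metis in_quotient_imp_subset subsetD)

lemma measurable_class_AE:
  assumes "F \<in> measurable_classes M" "f \<in> F" "g \<in> F"
  shows "AE x in M. f x = g x"
proof -
  have "(f, g) \<in> ae_eq M"
    using assms quotient_eq_iff[OF equiv_ae_eq, of F M F f g] by (simp add: measurable_classes_def)
  then show ?thesis by (simp add: ae_eq_def)
qed

lemma measurable_class_nonempty: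
  "F \<in> measurable_classes M \<Longrightarrow> \<exists>f. f \<in> F"
  using in_quotient_imp_non_empty[OF equiv_ae_eq] unfolding measurable_classes_def by blast

lemma converges_in_measure_cong:
  assumes "\<And>n. f n \<in> borel_measurable M" "\<And>n. f' n \<in> borel_measurable M"
    and "g \<in> borel_measurable M" "g' \<in> borel_measurable M"
    and "\<And>n. AE x in M. f n x = f' n x" "AE x in M. g x = g' x"
    and conv: "converges_in_measure M f g"
  shows "converges_in_measure M f' g'"
proof -
  note [measurable] = assms(1-4)
  have "emeasure M {x \<in> space M. \<bar>f n x - g x\<bar> > c} = emeasure M {x \<in> space M. \<bar>f' n x - g' x\<bar> > c}"
    for n c
  proof (rule emeasure_eq_AE)
    show "AE x in M. x \<in> {x \<in> space M. \<bar>f n x - g x\<bar> > c} \<longleftrightarrow> x \<in> {x \<in> space M. \<bar>f' n x - g' x\<bar> > c}"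
      using assms(5)[of n] assms(6) by eventually_elim auto
  qed measurable
  then show ?thesis using conv by (simp add: converges_in_measure_def)
qed

lemma class_converges_iff:
  assumes F: "\<And>n. F n \<in> measurable_classes M" and G: "G \<in> measurable_classes M"
    and f: "\<And>n. f n \<in> F n" and g: "g \<in> G"
  shows "class_converges M F G \<longleftrightarrow> converges_in_measure M f g"
proof
  assume "class_converges M F G"
  then obtain f' g' where f': "\<And>n. f' n \<in> F n" and g': "g' \<in> G"
    and "converges_in_measure M f' g'" unfolding class_converges_def by blast
  then show "converges_in_measure M f g"
    using converges_in_measure_cong[of f' M f g' g]
      measurable_class_rep[OF F f'] measurable_class_rep[OF F f]
      measurable_class_rep[OF G g'] measurable_class_rep[OF G g]
      measurable_class_AE[OF F f' f] measurable_class_AE[OF G g' g] by simp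
next
  assume "converges_in_measure M f g"
  then show "class_converges M F G" unfolding class_converges_def using f g by blast
qed

lemma class_converges_subseq:
  assumes "class_converges M F G" "strict_mono r"
  shows "class_converges M (F \<circ> r) G"
proof -
  obtain f g where f: "\<And>n. f n \<in> F n" "g \<in> G" and c: "converges_in_measure M f g"
    using assms(1) unfolding class_converges_def by blast
  have "converges_in_measure M (f \<circ> r) g"
    unfolding converges_in_measure_def
  proof (intro allI impI)
    fix c :: real assume "c > 0"
    then have "(\<lambda>n. emeasure M {x \<in> space M. \<bar>f n x - g x\<bar> > c}) \<longlonglongrightarrow> 0"
      using c by (simp add: converges_in_measure_def)
    from LIMSEQ_subseq_LIMSEQ[OF this assms(2)]
    show "(\<lambda>n. emeasure M {x \<in> space M. \<bar>(f \<circ> r) n x - g x\<bar> > c}) \<longlonglongrightarrow> 0"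
      by (simp add: o_def)
  qed
  then show ?thesis unfolding class_converges_def using f
    by (intro exI[of _ "f \<circ> r"] exI[of _ g]) auto
qed

lemma measure_closure_subset: "measure_closure M A \<subseteq> measurable_classes M"
  by (auto simp: measure_closure_def)

lemma measure_closure_mono: "A \<subseteq> B \<Longrightarrow> measure_closure M A \<subseteq> measure_closure M B"
  unfolding measure_closure_def by blast

lemma measure_closure_empty [simp]: "measure_closure M {} = {}"
  by (auto simp: measure_closure_def)

lemma subset_measure_closure:
  assumes "A \<subseteq> measurable_classes M"
  shows "A \<subseteq> measure_closure M A"
proof
  fix G assume G: "G \<in> A"
  then have GM: "G \<in> measurable_classes M" using assms by blast
  obtain g where "g \<in> G" using measurable_class_nonempty[OF GM] by blast
  moreover have "converges_in_measure M (\<lambda>n. g) g"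
    by (simp add: converges_in_measure_def)
  ultimately have "class_converges M (\<lambda>n. G) G"
    unfolding class_converges_def by (intro exI[of _ "\<lambda>n. g"] exI[of _ g]) auto
  then show "G \<in> measure_closure M A"
    using G GM by (auto simp: measure_closure_def)
qed

lemma measure_closure_Un:
  "measure_closure M (A \<union> B) = measure_closure M A \<union> measure_closure M B"
proof
  show "measure_closure M (A \<union> B) \<subseteq> measure_closure M A \<union> measure_closure M B"
  proof
    fix G assume "G \<in> measure_closure M (A \<union> B)"
    then obtain F where GM: "G \<in> measurable_classes M" and F: "\<And>n. F n \<in> A \<union> B"
      and c: "class_converges M F G" by (auto simp: measure_closure_def)
    have "infinite {n. F n \<in> A} \<or> infinite {n. F n \<in> B}"
    proof (rule ccontr)
      assume "\<not> ?thesis"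
      then have "finite ({n. F n \<in> A} \<union> {n. F n \<in> B})" by blast
      moreover have "{n. F n \<in> A} \<union> {n. F n \<in> B} = UNIV" using F by auto
      ultimately show False by simp
    qed
    moreover have "G \<in> measure_closure M C" if inf: "infinite {n. F n \<in> C}" for C
    proof -
      obtain r :: "nat \<Rightarrow> nat" where r: "strict_mono r" "\<And>n. r n \<in> {n. F n \<in> C}"
        using infinite_enumerate[OF inf] by blast
      then show ?thesis
        using GM class_converges_subseq[OF c r(1)] unfolding measure_closure_def
        by (auto intro!: exI[of _ "F \<circ> r"])
    qed
    ultimately show "G \<in> measure_closure M A \<union> measure_closure M B" by blast
  qed
qed (simp add: measure_closure_mono)

lemma istopology_measure:
  "istopology (\<lambda>U. \<exists>A \<subseteq> measurable_classes M.
     A = measure_closure M A \<and> U = measurable_classes M - A)"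
  unfolding istopology_def
proof (intro conjI allI impI)
  fix S T
  assume "\<exists>A \<subseteq> measurable_classes M. A = measure_closure M A \<and> S = measurable_classes M - A"
  then obtain A where A: "A \<subseteq> measurable_classes M" "measure_closure M A = A"
    "S = measurable_classes M - A" by metis
  assume "\<exists>A \<subseteq> measurable_classes M. A = measure_closure M A \<and> T = measurable_classes M - A"
  then obtain B where B: "B \<subseteq> measurable_classes M" "measure_closure M B = B"
    "T = measurable_classes M - B" by metis
  show "\<exists>A \<subseteq> measurable_classes M. A = measure_closure M A \<and> S \<inter> T = measurable_classes M - A"
    using A B by (intro exI[of _ "A \<union> B"]) (auto simp: measure_closure_Un)
next
  fix K :: "('a \<Rightarrow> real) set set set"
  assume K: "\<forall>U\<in>K. \<exists>A \<subseteq> measurable_classes M.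
     A = measure_closure M A \<and> U = measurable_classes M - A"
  define B where "B = measurable_classes M - \<Union>K"
  have 1: "measure_closure M B \<subseteq> B"
  proof
    fix G assume G: "G \<in> measure_closure M B"
    have "G \<notin> U" if "U \<in> K" for U
    proof -
      obtain A where A: "A \<subseteq> measurable_classes M" "measure_closure M A = A"
        "U = measurable_classes M - A" using bspec[OF K \<open>U \<in> K\<close>] by metis
      have "B \<subseteq> A" using \<open>U \<in> K\<close> A(3) by (auto simp: B_def)
      then have "G \<in> A" using G A(2) measure_closure_mono[of B A M] by blast
      then show ?thesis using A(3) by blast
    qed
    then show "G \<in> B" using G measure_closure_subset by (auto simp: B_def)
  qed
  have 2: "B \<subseteq> measure_closure M B"
    by (rule subset_measure_closure) (auto simp: B_def)
  have "\<Union>K \<subseteq> measurable_classes M"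
  proof (rule Union_least)
    fix U assume "U \<in> K"
    from bspec[OF K this] show "U \<subseteq> measurable_classes M" by (elim exE conjE) simp
  qed
  then have 3: "\<Union>K = measurable_classes M - B"
    by (auto simp: B_def)
  have "B \<subseteq> measurable_classes M" by (auto simp: B_def)
  then show "\<exists>A \<subseteq> measurable_classes M.
     A = measure_closure M A \<and> \<Union>K = measurable_classes M - A"
    using equalityI[OF 2 1] 3 by blast
qed

lemma openin_measure_topology:
  "openin (measure_topology M) U \<longleftrightarrow>
     (\<exists>A \<subseteq> measurable_classes M. A = measure_closure M A \<and> U = measurable_classes M - A)"
  unfolding measure_topology_def topology_inverse'[OF istopology_measure] ..

lemma topspace_measure_topology [simp]: "topspace (measure_topology M) = measurable_classes M"
proof
  have "openin (measure_topology M) (measurable_classes M)"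
    unfolding openin_measure_topology by (intro exI[of _ "{}"]) auto
  then show "measurable_classes M \<subseteq> topspace (measure_topology M)"
    by (rule openin_subset)
  show "topspace (measure_topology M) \<subseteq> measurable_classes M"
    using openin_topspace[of "measure_topology M"] unfolding openin_measure_topology by blast
qed

end

theory Submission
  imports Defs
begin

text \<open>Segments are continuous in measure: if \<open>t\<^sub>n \<longlongrightarrow> t\<close>, then
  \<open>(1 - t\<^sub>n) f + t\<^sub>n g\<close> converges pointwise, hence (the measure being finite) in measure, to
  \<open>(1 - t) f + t g\<close>. So the whole space is path connected, and all three components of a point
  are the whole space.\<close>

text \<open>Dominated convergence for the indicators of the deviation sets: almost everywhere they
  tend to 0, and they are bounded by the constant 1, which is integrable because the measure is
  finite.\<close>

lemma (in finite_measure) converges_in_measure_AE: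
  fixes f :: "nat \<Rightarrow> 'a \<Rightarrow> real"
  assumes [measurable]: "\<And>n. f n \<in> borel_measurable M" "g \<in> borel_measurable M"
    and lim: "AE x in M. (\<lambda>n. f n x) \<longlonglongrightarrow> g x"
  shows "converges_in_measure M f g"
  unfolding converges_in_measure_def
proof (intro allI impI)
  fix c :: real assume "c > 0"
  let ?S = "\<lambda>n. {x \<in> space M. \<bar>f n x - g x\<bar> > c}"
  have "(\<lambda>n. integral\<^sup>L M (indicat_real (?S n))) \<longlonglongrightarrow> integral\<^sup>L M (\<lambda>x. 0)"
  proof (rule integral_dominated_convergence[where w = "\<lambda>_. 1"])
    show "AE x in M. (\<lambda>n. indicat_real (?S n) x) \<longlonglongrightarrow> 0"
      using lim
    proof eventually_elim
      case (elim x)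
      \<comment> \<open>Once \<open>f n x\<close> stays within \<open>c\<close> of
        \<open>g x\<close>, the point \<open>x\<close> has left the deviation sets for good, so the
        indicators at \<open>x\<close> are eventually constantly 0.\<close>
      have "eventually (\<lambda>n. dist (f n x) (g x) < c) sequentially"
        using elim \<open>c > 0\<close> by (rule tendstoD)
      then have "eventually (\<lambda>n. indicat_real (?S n) x = 0) sequentially"
        by eventually_elim (auto simp: dist_real_def indicator_def)
      then show ?case by (rule tendsto_eventually)
    qed
  qed (auto simp: indicator_def)
  then have "(\<lambda>n. measure M (?S n)) \<longlonglongrightarrow> 0" by simp
  \<comment> \<open>By finiteness \<open>emeasure\<close> is the \<open>ennreal\<close> image of the
    real-valued \<open>measure\<close>, so the real limit transfers.\<close>
  then show "(\<lambda>n. emeasure M (?S n)) \<longlonglongrightarrow> 0"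
    by (simp add: emeasure_eq_measure tendsto_ennrealI[where x = 0, simplified])
qed

text \<open>The topology is given by complements of fixed points of \<open>measure_closure\<close>;
  complementing twice inside \<open>measurable_classes M\<close> recovers the fixed point
  itself.\<close>

lemma closedin_measure_topology:
  "closedin (measure_topology M) A \<longleftrightarrow>
    A \<subseteq> measurable_classes M \<and> measure_closure M A = A"
  unfolding closedin_def openin_measure_topology topspace_measure_topology
  by (metis Diff_subset double_diff subset_refl)

lemma class_of_mem_measurable_classes:
  "f \<in> borel_measurable M \<Longrightarrow> ae_eq M `` {f} \<in> measurable_classes M"
  unfolding measurable_classes_def by (rule quotientI)

lemma mem_class_of: "f \<in> borel_measurable M \<Longrightarrow> f \<in> ae_eq M `` {f}"
  by (simp add: ae_eq_def)

lemma class_of_eq: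
  "F \<in> measurable_classes M \<Longrightarrow> f \<in> F \<Longrightarrow> ae_eq M `` {f} = F"
  unfolding measurable_classes_def
  by (metis Image_singleton_iff equiv_ae_eq equiv_class_eq quotientE)

text \<open>Preimages of closed sets are closed: first countability of the domain yields a sequence
  in the preimage tending to any given limit point, and a closed set in the codomain contains the
  limits in measure of its sequences by construction.\<close>

lemma continuous_map_measure_topology_sequentially:
  fixes S :: "'b::first_countable_topology set"
  assumes mem: "\<And>t. t \<in> S \<Longrightarrow> p t \<in> measurable_classes M"
    and seq: "\<And>s t. (\<And>n. s n \<in> S) \<Longrightarrow> t \<in> S \<Longrightarrow> s \<longlonglongrightarrow> t \<Longrightarrow> class_converges M (\<lambda>n. p (s n)) (p t)"
  shows "continuous_map (top_of_set S) (measure_topology M) p"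
  unfolding continuous_map_closedin
proof (intro conjI allI impI)
  fix C assume "closedin (measure_topology M) C"
  then have C: "measure_closure M C = C"
    by (simp add: closedin_measure_topology)
  \<comment> \<open>By \<open>closedin_limpt\<close>, closedness relative to \<open>S\<close> is
    tested at the limit points that lie in \<open>S\<close>.\<close>
  have "p l \<in> C"
    if lim: "l islimpt {t \<in> S. p t \<in> C}" and l: "l \<in> S" for l
  proof -
    obtain x where x: "\<And>n. x n \<in> {t \<in> S. p t \<in> C} - {l}" "x \<longlonglongrightarrow> l"
      using lim unfolding islimpt_sequential by blast
    then have "class_converges M (\<lambda>n. p (x n)) (p l)"
      using l by (intro seq) auto
    then have "p l \<in> measure_closure M C"
      unfolding measure_closure_def using x l mem by (auto intro!: exI[of _ "\<lambda>n. p (x n)"])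
    then show ?thesis using C by simp
  qed
  then show "closedin (top_of_set S) {x \<in> topspace (top_of_set S). p x \<in> C}"
    unfolding closedin_limpt by simp
qed (use mem in auto)

lemma (in finite_measure) path_connected_space_measure_topology:
  "path_connected_space (measure_topology M)"
  unfolding path_connected_space_def topspace_measure_topology
proof (intro ballI)
  fix F G assume F: "F \<in> measurable_classes M" and G: "G \<in> measurable_classes M"
  obtain f g where f: "f \<in> F" and g: "g \<in> G"
    using F G measurable_class_nonempty by metis
  note [measurable] = measurable_class_rep[OF F f] measurable_class_rep[OF G g]
  \<comment> \<open>The segment is formed between chosen representatives; \<open>p\<close> then
    takes it to classes.\<close>
  define h where "h = (\<lambda>(t::real) x. (1 - t) * f x + t * g x)"
  have h[measurable]: "h t \<in> borel_measurable M" for t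
    by (simp add: h_def)
  define p where "p = (\<lambda>t. ae_eq M `` {h t})"
  have "continuous_map (top_of_set {0..1}) (measure_topology M) p"
  proof (rule continuous_map_measure_topology_sequentially)
    fix s :: "nat \<Rightarrow> real" and t assume "s \<longlonglongrightarrow> t"
    then have "converges_in_measure M (\<lambda>n. h (s n)) (h t)"
      \<comment> \<open>For fixed \<open>x\<close>, \<open>h t x\<close> is affine in
        \<open>t\<close>, so the convergence holds at every point.\<close>
      by (intro converges_in_measure_AE h AE_I2) (simp add: h_def, intro tendsto_intros)
    then show "class_converges M (\<lambda>n. p (s n)) (p t)"
      unfolding class_converges_def p_def using mem_class_of[OF h]
      by (intro exI[of _ "\<lambda>n. h (s n)"] exI[of _ "h t"]) simp
  qed (simp add: p_def class_of_mem_measurable_classes)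
  \<comment> \<open>\<open>h 0\<close> and \<open>h 1\<close> are \<open>f\<close> and
    \<open>g\<close>, and a class is generated by any of its members.\<close>
  moreover have "p 0 = F" "p 1 = G"
    using class_of_eq[OF F f] class_of_eq[OF G g] by (simp_all add: p_def h_def)
  ultimately show "\<exists>p. pathin (measure_topology M) p \<and> p 0 = F \<and> p 1 = G"
    unfolding pathin_def by blast
qed

theorem theorem4p8:
  fixes M :: "'a measure"
  assumes "prob_space M"
    and "F \<in> measurable_classes M"
  shows "quasi_component_of_set (measure_topology M) F = connected_component_of_set (measure_topology M) F
    \<and> connected_component_of_set (measure_topology M) F = path_component_of_set (measure_topology M) F"
proof -
  interpret prob_space M by fact
  have F: "F \<in> topspace (measure_topology M)"
    using assms(2) by simp
  have path: "path_component_of_set (measure_topology M) F = topspace (measure_topology M)"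
    using path_connected_space_measure_topology F
    by (auto simp: path_connected_space_path_component_set)
  \<comment> \<open>In every space these sets form a chain: path component, component,
    quasicomponent, whole space. Here the smallest is already the whole space, so the chain
    collapses.\<close>
  have "path_component_of_set (measure_topology M) F \<subseteq> connected_component_of_set (measure_topology M) F"
    by (rule path_component_subset_connected_component_of)
  moreover have "connected_component_of_set (measure_topology M) F \<subseteq> quasi_component_of_set (measure_topology M) F"
    by (rule connected_component_subset_quasi_component_of)
  moreover have "quasi_component_of_set (measure_topology M) F \<subseteq> topspace (measure_topology M)"
    by (rule quasi_component_of_subset_topspace)
  ultimately show ?thesis using path by blast
qed

end
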